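(* Let $1<p<\infty$. There is a constant $C(p)$ depending only on $p$ such that, if $\Omega\subset\mathbb{R}^2$ is a domain, $u=(u^1,u^2)\in C^2(\Omega,\mathbb{R}^2)$ is a $p$-harmonic map and $f,g$ are the complex gradients of $u^1,u^2$, then at all points of $\Omega$ where $f\neq0$ and $g\ne 0$ it holds that $$|\phi_{u^1}|\,|f|\le C(p)\,(|f_z|+|g_z|),\qquad |\phi_{u^2}|\,|g|\le C(p)\,(|f_z|+|g_z|).$$
   Context: For $1<p<\infty$, a map $u=(u^1,u^2):\Omega\subset\mathbb{R}^2\to\mathbb{R}^2$ is $p$-harmonic if it is a (weak) solution of the system $\operatorname{div}(|Du|^{p-2}\nabla u^1)=0$, $\operatorname{div}(|Du|^{p-2}\nabla u^2)=0$ in $\Omega$, where $|Du|^2=|\nabla u^1|^2+|\nabla u^2|^2$. The complex gradients are $f=\tfrac12(u^1_x-iu^1_y)$ and $g=\tfrac12(u^2_x-iu^2_y)$; $\partial/\partial z=\tfrac12(\partial_x-i\partial_y)$, and a subscript $z$ denotes this derivative. For a $C^2$ function $v$, at points where $\nabla v\neq 0$, let $$k_v=-\frac{v_y^2v_{xx}-2v_xv_yv_{xy}+v_x^2v_{yy}}{|\nabla v|^3},\qquad h_v=\frac{(v_{xx}-v_{yy})v_xv_y-v_{xy}(v_x^2-v_y^2)}{|\nabla v|^3}$$ be the curvature of the level curves of $v$ and the curvature of their orthogonal trajectories (lines of steepest descent), and set $$\phi_v=k_v+ih_v=-2\,\frac{\partial}{\partial z}\left(\frac{\overline{F}}{|F|}\right),\qquad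 F=v_x-iv_y.$$ *)

theory Defs
  imports "HOL-Analysis.Analysis"
begin

definition px :: "(real \<times> real \<Rightarrow> 'a::real_normed_vector) \<Rightarrow> real \<times> real \<Rightarrow> 'a" where
  "px v z = vector_derivative (\<lambda>t. v (t, snd z)) (at (fst z))"

definition py :: "(real \<times> real \<Rightarrow> 'a::real_normed_vector) \<Rightarrow> real \<times> real \<Rightarrow> 'a" where
  "py v z = vector_derivative (\<lambda>t. v (fst z, t)) (at (snd z))"

text \<open>The class \<open>C\<^sup>k\<close> on a set \<open>S\<close>, to be used for open \<open>S\<close> only. Differentiability is
  demanded so that the partial derivatives are not merely the default values of
  \<^const>\<open>vector_derivative\<close>.\<close>

primrec Ck_on :: "nat \<Rightarrow> (real \<times> real) set \<Rightarrow> (real \<times> real \<Rightarrow> 'a::real_normed_vector) \<Rightarrow> bool" where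
  "Ck_on 0 S v \<longleftrightarrow> continuous_on S v"
| "Ck_on (Suc k) S v \<longleftrightarrow> v differentiable_on S \<and> Ck_on k S (px v) \<and> Ck_on k S (py v)"

definition grad :: "(real \<times> real \<Rightarrow> real) \<Rightarrow> real \<times> real \<Rightarrow> real \<times> real" where
  "grad v z = (px v z, py v z)"

definition norm_D :: "(real \<times> real \<Rightarrow> real \<times> real) \<Rightarrow> real \<times> real \<Rightarrow> real" where
  "norm_D u z = sqrt ((norm (grad (fst \<circ> u) z))\<^sup>2 + (norm (grad (snd \<circ> u) z))\<^sup>2)"

definition test_function :: "(real \<times> real) set \<Rightarrow> (real \<times> real \<Rightarrow> real) \<Rightarrow> bool" where
  "test_function \<Omega> \<eta> \<longleftrightarrow> (\<forall>k. Ck_on k UNIV \<eta>) \<and>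
     compact (closure {z. \<eta> z \<noteq> 0}) \<and> closure {z. \<eta> z \<noteq> 0} \<subseteq> \<Omega>"

text \<open>Weak solutions, tested against \<open>C\<^sub>c\<^sup>\<infinity>(\<Omega>)\<close>. The gradients are the classical ones, so the
  definition is meant for maps that are at least \<open>C\<^sup>1\<close>, for which they coincide with the weak
  gradients. Where \<open>Du\<close> vanishes, the field \<open>|Du|\<^sup>p\<^sup>-\<^sup>2 \<nabla>u\<^sup>j\<close> is zero, also for \<open>p < 2\<close>.\<close>

definition p_harmonic :: "real \<Rightarrow> (real \<times> real) set \<Rightarrow> (real \<times> real \<Rightarrow> real \<times> real) \<Rightarrow> bool" where
  "p_harmonic p \<Omega> u \<longleftrightarrow> (\<forall>\<eta>. test_function \<Omega> \<eta> \<longrightarrow>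
     (LINT z:\<Omega>|lborel. ((norm_D u z powr (p - 2)) *\<^sub>R grad (fst \<circ> u) z) \<bullet> grad \<eta> z) = 0 \<and>
     (LINT z:\<Omega>|lborel. ((norm_D u z powr (p - 2)) *\<^sub>R grad (snd \<circ> u) z) \<bullet> grad \<eta> z) = 0)"

definition dz :: "(real \<times> real \<Rightarrow> complex) \<Rightarrow> real \<times> real \<Rightarrow> complex" where
  "dz F z = (px F z - \<i> * py F z) / 2"

definition complex_gradient :: "(real \<times> real \<Rightarrow> real) \<Rightarrow> real \<times> real \<Rightarrow> complex" where
  "complex_gradient v z = (complex_of_real (px v z) - \<i> * complex_of_real (py v z)) / 2"

definition level_curvature :: "(real \<times> real \<Rightarrow> real) \<Rightarrow> real \<times> real \<Rightarrow> real" where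
  "level_curvature v z =
     - (((py v z)\<^sup>2 * px (px v) z - 2 * px v z * py v z * py (px v) z + (px v z)\<^sup>2 * py (py v) z)
        / norm (grad v z) ^ 3)"

definition descent_curvature :: "(real \<times> real \<Rightarrow> real) \<Rightarrow> real \<times> real \<Rightarrow> real" where
  "descent_curvature v z =
     ((px (px v) z - py (py v) z) * px v z * py v z
        - py (px v) z * ((px v z)\<^sup>2 - (py v z)\<^sup>2))
     / norm (grad v z) ^ 3"

text \<open>For \<open>v\<close> of class \<open>C\<^sup>2\<close> and \<open>\<nabla>v \<noteq> 0\<close> this equals \<open>-2 \<partial>/\<partial>z (cnj F / |F|)\<close> with
  \<open>F = v\<^sub>x - i v\<^sub>y\<close>.\<close>

definition phi :: "(real \<times> real \<Rightarrow> real) \<Rightarrow> real \<times> real \<Rightarrow> complex" where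
  "phi v z = complex_of_real (level_curvature v z) + \<i> * complex_of_real (descent_curvature v z)"

end

theory Submission
  imports Defs
begin

text \<open>Write \<open>A = u\<^sup>1\<^sub>x + i u\<^sup>1\<^sub>y\<close> and \<open>L = \<Delta>u\<^sup>1\<close>, and let \<open>H = 2 f\<^sub>z\<close>, which encodes the trace-free part of
  the Hessian of \<open>u\<^sup>1\<close>; let \<open>B\<close>, \<open>K\<close>, \<open>G = 2 g\<^sub>z\<close> be the same quantities for \<open>u\<^sup>2\<close>. Expanding the
  curvatures gives \<open>\<phi> |A|\<^sup>3 = H A\<^sup>2 - |A|\<^sup>2 L / 2\<close> with \<open>|A| = 2 |f|\<close>, whence \<open>|\<phi>| |f| \<le> |f\<^sub>z| + |L| / 4\<close>
  (\<open>phi_bound\<close>). It remains to control the Laplacians by \<open>|f\<^sub>z| + |g\<^sub>z|\<close>.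

  Where \<open>N = |Du|\<^sup>2\<close> is positive, the field \<open>|Du|\<^sup>p\<^sup>-\<^sup>2 \<nabla>u\<^sup>j\<close> is \<open>C\<^sup>1\<close>, so that testing with bump
  functions on small rectangles turns the weak equation into a pointwise one
  (\<open>divergence_free_if_weakly\<close>, \<open>p_laplace_pointwise\<close>). In complex form the system reads
  \<open>N L + (p - 2) Re (Z A) = 0\<close> and \<open>N K + (p - 2) Re (Z B) = 0\<close>, where
  \<open>Z = cnj Y / 2 + H A + G B\<close> with \<open>Y = L A + K B\<close> is half of \<open>N\<^sub>x - i N\<^sub>y\<close>. Adding \<open>L\<close> times the first
  equation to \<open>K\<close> times the second yields
  \<open>N (L\<^sup>2 + K\<^sup>2) + (p - 2)/2 |Y|\<^sup>2 = - (p - 2) Re ((H A + G B) Y)\<close>. By Cauchy-Schwarz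
  \<open>|Y|\<^sup>2 \<le> N (L\<^sup>2 + K\<^sup>2)\<close>; hence the left side is at least \<open>min 1 (p/2) N (L\<^sup>2 + K\<^sup>2)\<close>, and dividing
  out one factor bounds the Laplacians (\<open>trace_bound\<close>). The identification \<open>H = 2 f\<^sub>z\<close> rests on the
  symmetry of the second derivatives, proved in \<open>mixed_partials_eq\<close>.\<close>

section \<open>Slices and partial derivatives\<close>

lemma differentiable_px:
  fixes v :: "real \<times> real \<Rightarrow> 'a::real_normed_vector"
  assumes "v differentiable (at (x, y))"
  shows "((\<lambda>t. v (t, y)) has_vector_derivative px v (x, y)) (at x)"
proof -
  obtain D where "(v has_derivative D) (at (x, y))"
    using assms by (auto simp: differentiable_def)
  moreover have "((\<lambda>t. (t, y)) has_derivative (\<lambda>h. (h, 0))) (at x)"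
    by (auto intro!: derivative_eq_intros)
  ultimately have "((\<lambda>t. v (t, y)) has_derivative (\<lambda>h. D (h, 0))) (at x)"
    by (rule has_derivative_compose[rotated])
  then have "(\<lambda>t. v (t, y)) differentiable (at x)"
    by (auto simp: differentiable_def)
  then show ?thesis by (simp add: px_def vector_derivative_works)
qed

lemma differentiable_py:
  fixes v :: "real \<times> real \<Rightarrow> 'a::real_normed_vector"
  assumes "v differentiable (at (x, y))"
  shows "((\<lambda>t. v (x, t)) has_vector_derivative py v (x, y)) (at y)"
proof -
  obtain D where "(v has_derivative D) (at (x, y))"
    using assms by (auto simp: differentiable_def)
  moreover have "((\<lambda>t. (x, t)) has_derivative (\<lambda>h. (0, h))) (at y)"
    by (auto intro!: derivative_eq_intros)
  ultimately have "((\<lambda>t. v (x, t)) has_derivative (\<lambda>h. D (0, h))) (at y)"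
    by (rule has_derivative_compose[rotated])
  then have "(\<lambda>t. v (x, t)) differentiable (at y)"
    by (auto simp: differentiable_def)
  then show ?thesis by (simp add: py_def vector_derivative_works)
qed

lemma px_eqI: "((\<lambda>t. v (t, y)) has_vector_derivative d) (at x) \<Longrightarrow> px v (x, y) = d"
  by (simp add: px_def vector_derivative_at)

lemma py_eqI: "((\<lambda>t. v (x, t)) has_vector_derivative d) (at y) \<Longrightarrow> py v (x, y) = d"
  by (simp add: py_def vector_derivative_at)

lemma px_cong_open:
  assumes "open S" "z \<in> S" "\<And>z. z \<in> S \<Longrightarrow> v z = w z"
  shows "px v z = px w z"
proof -
  have "open ((\<lambda>t. (t, snd z)) -` S)"
    using assms(1) by (intro open_vimage) (auto intro!: continuous_intros)
  then have "eventually (\<lambda>t. (t, snd z) \<in> S) (nhds (fst z))"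
    using assms(2) by (auto simp: eventually_nhds)
  then have "eventually (\<lambda>t. v (t, snd z) = w (t, snd z)) (nhds (fst z))"
    by eventually_elim (use assms(3) in auto)
  then show ?thesis
    unfolding px_def by (intro vector_derivative_cong_eq) auto
qed

lemma py_cong_open:
  assumes "open S" "z \<in> S" "\<And>z. z \<in> S \<Longrightarrow> v z = w z"
  shows "py v z = py w z"
proof -
  have "open ((\<lambda>t. (fst z, t)) -` S)"
    using assms(1) by (intro open_vimage) (auto intro!: continuous_intros)
  then have "eventually (\<lambda>t. (fst z, t) \<in> S) (nhds (snd z))"
    using assms(2) by (auto simp: eventually_nhds)
  then have "eventually (\<lambda>t. v (fst z, t) = w (fst z, t)) (nhds (snd z))"
    by eventually_elim (use assms(3) in auto)
  then show ?thesis
    unfolding py_def by (intro vector_derivative_cong_eq) auto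
qed

text \<open>Openness of \<open>S\<close> is essential: partial derivatives at a point of \<open>S\<close> see the values in a
  neighbourhood.\<close>

lemma Ck_on_cong:
  assumes "open S" "\<And>z. z \<in> S \<Longrightarrow> v z = w z" "Ck_on k S v"
  shows "Ck_on k S w"
  using assms(2,3)
proof (induction k arbitrary: v w)
  case 0
  then show ?case by (simp cong: continuous_on_cong)
next
  case (Suc k)
  have "w differentiable_on S"
    using Suc.prems by (auto simp: differentiable_on_def intro: differentiable_transform_within[OF _ zero_less_one])
  moreover have "Ck_on k S (px w)"
    by (rule Suc.IH[of "px v"]) (use Suc.prems in \<open>auto intro!: px_cong_open[OF assms(1)]\<close>)
  moreover have "Ck_on k S (py w)"
    by (rule Suc.IH[of "py v"]) (use Suc.prems in \<open>auto intro!: py_cong_open[OF assms(1)]\<close>)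
  ultimately show ?case by simp
qed

lemma Ck_on_bounded_linear:
  fixes u :: "real \<times> real \<Rightarrow> 'a::real_normed_vector"
  assumes T: "bounded_linear T" and S: "open S"
  shows "Ck_on k S u \<Longrightarrow> Ck_on k S (T \<circ> u)"
proof (induction k arbitrary: u)
  case 0
  then show ?case using T by (auto simp: o_def intro: bounded_linear.continuous_on)
next
  case (Suc k)
  have d: "u differentiable (at z)" if "z \<in> S" for z
    using Suc.prems S that by (simp add: differentiable_on_eq_differentiable_at)
  have "(T \<circ> u) differentiable (at z)" if "z \<in> S" for z
    using d[OF that] bounded_linear.has_derivative[OF T]
    unfolding differentiable_def o_def by blast
  then have "(T \<circ> u) differentiable_on S"
    by (simp add: differentiable_on_eq_differentiable_at S del: split_paired_All)
  moreover have "Ck_on k S (px (T \<circ> u))"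
  proof (rule Ck_on_cong[OF S])
    show "Ck_on k S (T \<circ> px u)" using Suc.IH Suc.prems unfolding Ck_on.simps by blast
    fix z assume "z \<in> S"
    then have "((\<lambda>t. u (t, snd z)) has_vector_derivative px u z) (at (fst z))"
      using differentiable_px[of u "fst z" "snd z"] d by simp
    from bounded_linear.has_vector_derivative[OF T this]
    show "(T \<circ> px u) z = px (T \<circ> u) z"
      using px_eqI[of "T \<circ> u" "snd z" _ "fst z"] by simp
  qed
  moreover have "Ck_on k S (py (T \<circ> u))"
  proof (rule Ck_on_cong[OF S])
    show "Ck_on k S (T \<circ> py u)" using Suc.IH Suc.prems unfolding Ck_on.simps by blast
    fix z assume "z \<in> S"
    then have "((\<lambda>t. u (fst z, t)) has_vector_derivative py u z) (at (snd z))"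
      using differentiable_py[of u "fst z" "snd z"] d by simp
    from bounded_linear.has_vector_derivative[OF T this]
    show "(T \<circ> py u) z = py (T \<circ> u) z"
      using py_eqI[of "T \<circ> u" "fst z" _ "snd z"] by simp
  qed
  ultimately show ?case unfolding Ck_on.simps by blast
qed

section \<open>Smooth bump functions on rectangles\<close>

text \<open>The functions \<open>t\<^sup>-\<^sup>n exp (-1/t)\<close>, extended by zero to \<open>t \<le> 0\<close>. The family, rather than the
  case \<open>n = 0\<close> alone, is needed because it is closed under differentiation up to linear
  combinations; smoothness then follows by induction on the order.\<close>

definition flat :: "nat \<Rightarrow> real \<Rightarrow> real" where
  "flat n t = (if t > 0 then exp (- (1 / t)) / t ^ n else 0)"

lemma flat_tendsto_0: "(flat n \<longlongrightarrow> 0) (at 0)"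
proof -
  have "((\<lambda>s. flat n (inverse s)) \<longlongrightarrow> 0) at_top"
  proof (rule Lim_transform_eventually)
    show "((\<lambda>s::real. s ^ n / exp s) \<longlongrightarrow> 0) at_top" by (rule tendsto_power_div_exp_0)
    show "\<forall>\<^sub>F s in at_top. s ^ n / exp s = flat n (inverse s)"
      using eventually_gt_at_top[of "0::real"]
      by eventually_elim (simp add: flat_def exp_minus field_simps)
  qed
  then have "(flat n \<longlongrightarrow> 0) (at_right 0)"
    by (simp add: filterlim_at_right_to_top)
  moreover have "(flat n \<longlongrightarrow> 0) (at_left 0)"
    by (rule Lim_transform_eventually[OF tendsto_const])
       (auto simp: eventually_at_left_field flat_def intro!: exI[of _ "-1"])
  ultimately show ?thesis by (simp add: filterlim_split_at)
qed

text \<open>At the origin the difference quotient of \<open>flat n\<close> is \<open>flat (n + 1)\<close>, which tends to zero.\<close>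

lemma flat_has_derivative:
  "(flat n has_real_derivative (flat (n + 2) t - real n * flat (n + 1) t)) (at t)"
proof -
  consider "t > 0" | "t < 0" | "t = 0" by linarith
  then show ?thesis
  proof cases
    case 1
    have "((\<lambda>t. exp (- (1 / t)) / t ^ n) has_real_derivative
        (flat (n + 2) t - real n * flat (n + 1) t)) (at t)"
      using 1
      apply (auto intro!: derivative_eq_intros simp: flat_def)
      apply (cases n; simp add: field_simps power2_eq_square)
      done
    then show ?thesis
      by (rule has_field_derivative_transform_within_open[of _ _ _ "{0<..}"])
         (use 1 in \<open>auto simp: flat_def\<close>)
  next
    case 2
    have "((\<lambda>t. 0) has_real_derivative (flat (n + 2) t - real n * flat (n + 1) t)) (at t)"
      using 2 by (simp add: flat_def)
    then show ?thesis
      by (rule has_field_derivative_transform_within_open[of _ _ _ "{..<0}"])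
         (use 2 in \<open>auto simp: flat_def\<close>)
  next
    case 3
    have "((\<lambda>h. flat n h / h) \<longlongrightarrow> 0) (at 0)"
      by (rule Lim_transform_eventually[OF flat_tendsto_0[of "Suc n"]])
         (auto simp: flat_def eventually_at_filter field_simps)
    then show ?thesis
      using 3 by (simp add: has_field_derivative_iff flat_def)
  qed
qed

lemma Ck_on_mono: "Ck_on (Suc k) S v \<Longrightarrow> Ck_on k S v"
proof (induction k arbitrary: v)
  case 0
  then show ?case by (simp add: differentiable_imp_continuous_on)
next
  case (Suc k)
  then show ?case by (metis Ck_on.simps(2))
qed

lemma Ck_on_add:
  fixes v w :: "real \<times> real \<Rightarrow> real"
  shows "Ck_on k UNIV v \<Longrightarrow> Ck_on k UNIV w \<Longrightarrow> Ck_on k UNIV (\<lambda>z. v z + w z)"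
proof (induction k arbitrary: v w)
  case 0
  then show ?case by (auto intro: continuous_intros)
next
  case (Suc k)
  have d: "v differentiable (at z)" "w differentiable (at z)" for z
    using Suc.prems by (simp_all add: differentiable_on_def del: split_paired_All)
  have "px (\<lambda>z. v z + w z) = (\<lambda>z. px v z + px w z)" "py (\<lambda>z. v z + w z) = (\<lambda>z. py v z + py w z)"
    by (auto intro!: px_eqI py_eqI derivative_intros differentiable_px differentiable_py d)
  then show ?case using Suc by (auto intro: derivative_intros)
qed

lemma Ck_on_mult:
  fixes v w :: "real \<times> real \<Rightarrow> real"
  shows "Ck_on k UNIV v \<Longrightarrow> Ck_on k UNIV w \<Longrightarrow> Ck_on k UNIV (\<lambda>z. v z * w z)"
proof (induction k arbitrary: v w)
  case 0
  then show ?case by (auto intro: continuous_intros)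
next
  case (Suc k)
  have d: "v differentiable (at z)" "w differentiable (at z)" for z
    using Suc.prems by (simp_all add: differentiable_on_def del: split_paired_All)
  have x: "px (\<lambda>z. v z * w z) = (\<lambda>z. v z * px w z + px v z * w z)"
    by (auto intro!: px_eqI has_vector_derivative_mult differentiable_px d)
  have y: "py (\<lambda>z. v z * w z) = (\<lambda>z. v z * py w z + py v z * w z)"
    by (auto intro!: py_eqI has_vector_derivative_mult differentiable_py d)
  have "Ck_on k UNIV v" "Ck_on k UNIV w"
    using Suc.prems Ck_on_mono by blast+
  moreover have "Ck_on k UNIV (px v)" "Ck_on k UNIV (px w)" "Ck_on k UNIV (py v)" "Ck_on k UNIV (py w)"
    using Suc.prems by simp_all
  moreover have "(\<lambda>z. v z * w z) differentiable_on UNIV"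
    using Suc.prems by (intro differentiable_on_mult) auto
  ultimately show ?case
    unfolding Ck_on.simps x y by (intro conjI Ck_on_add Suc.IH) assumption+
qed

lemma Ck_on_const: "Ck_on k UNIV (\<lambda>z. c :: real)"
proof (induction k arbitrary: c)
  case (Suc k)
  have "px (\<lambda>z. c) = (\<lambda>z. 0)" "py (\<lambda>z. c) = (\<lambda>z. 0)"
    by (simp_all add: px_def [abs_def] py_def [abs_def])
  then show ?case using Suc by simp
qed simp

text \<open>Composition with affine functions is enough to build bumps: a rectangle is an intersection of
  four half planes.\<close>

lemma Ck_on_flat_affine: "Ck_on k UNIV (\<lambda>z. flat n (c + z \<bullet> d))"
proof (induction k arbitrary: n)
  case 0
  have "continuous_on UNIV (flat n)" for n
    by (meson DERIV_continuous_on flat_has_derivative has_field_derivative_at_within)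
  then show ?case
    by (simp, rule continuous_on_compose2[of UNIV "flat n"]) (auto intro!: continuous_intros)
next
  case (Suc k)
  define F where "F m z = flat m (c + z \<bullet> d)" for m z
  have d1: "(F n has_derivative (\<lambda>h. (h \<bullet> d) * (F (n + 2) z - real n * F (n + 1) z))) (at z)" for z
  proof -
    have "((\<lambda>z. c + z \<bullet> d) has_derivative (\<lambda>h. h \<bullet> d)) (at z)"
      by (auto intro!: derivative_eq_intros)
    from has_derivative_compose[OF this flat_has_derivative[unfolded has_field_derivative_def]]
    show ?thesis by (simp add: F_def [abs_def] mult.commute)
  qed
  have "F n differentiable_on UNIV"
    unfolding differentiable_on_def differentiable_def using d1 by blast
  have x: "px (F n) = (\<lambda>z. fst d * (F (n + 2) z + (- real n) * F (n + 1) z))"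
  proof (rule ext)
    fix z :: "real \<times> real"
    obtain x y where z: "z = (x, y)" by (cases z)
    have "((\<lambda>t. c + (t, y) \<bullet> d) has_real_derivative fst d) (at x)"
      by (cases d) (auto intro!: derivative_eq_intros simp: inner_prod_def)
    from DERIV_chain2[OF flat_has_derivative this]
    show "px (F n) z = fst d * (F (n + 2) z + (- real n) * F (n + 1) z)"
      unfolding z F_def
      by (intro px_eqI) (simp add: has_real_derivative_iff_has_vector_derivative mult.commute)
  qed
  have y: "py (F n) = (\<lambda>z. snd d * (F (n + 2) z + (- real n) * F (n + 1) z))"
  proof (rule ext)
    fix z :: "real \<times> real"
    obtain x y where z: "z = (x, y)" by (cases z)
    have "((\<lambda>t. c + (x, t) \<bullet> d) has_real_derivative snd d) (at y)"
      by (cases d) (auto intro!: derivative_eq_intros simp: inner_prod_def)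
    from DERIV_chain2[OF flat_has_derivative this]
    show "py (F n) z = snd d * (F (n + 2) z + (- real n) * F (n + 1) z)"
      unfolding z F_def
      by (intro py_eqI) (simp add: has_real_derivative_iff_has_vector_derivative mult.commute)
  qed
  have "Ck_on (Suc k) UNIV (F n)"
    unfolding Ck_on.simps x y using \<open>F n differentiable_on UNIV\<close> Suc.IH
    by (intro conjI Ck_on_mult Ck_on_add Ck_on_const) (simp_all add: F_def [abs_def])
  then show ?case by (simp add: F_def [abs_def])
qed

definition bump :: "real \<times> real \<Rightarrow> real \<times> real \<Rightarrow> real \<times> real \<Rightarrow> real" where
  "bump l r z = flat 0 (- fst l + z \<bullet> (1, 0)) * flat 0 (fst r + z \<bullet> (-1, 0)) *
     (flat 0 (- snd l + z \<bullet> (0, 1)) * flat 0 (snd r + z \<bullet> (0, -1)))"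

lemma Ck_on_bump: "Ck_on k UNIV (bump l r)"
  unfolding bump_def [abs_def] by (intro Ck_on_mult Ck_on_flat_affine)

lemma bump_nonzero_iff: "bump l r z \<noteq> 0 \<longleftrightarrow> z \<in> box l r"
  by (auto simp: bump_def flat_def box_def Basis_prod_def inner_prod_def split: if_splits)

lemma bump_pos: "z \<in> box l r \<Longrightarrow> bump l r z > 0"
  by (auto simp: bump_def flat_def box_def Basis_prod_def inner_prod_def)

lemma test_function_bump:
  assumes "cbox l r \<subseteq> S"
  shows "test_function S (bump l r)"
proof -
  have "closure {z. bump l r z \<noteq> 0} \<subseteq> cbox l r"
    by (intro closure_minimal) (use box_subset_cbox in \<open>auto simp: bump_nonzero_iff\<close>)
  then show ?thesis
    using assms bounded_subset[OF bounded_cbox]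
    by (auto simp: test_function_def Ck_on_bump compact_closure bump_nonzero_iff compact_eq_bounded_closed)
qed

section \<open>From the weak to the pointwise equation\<close>

lemma integral_px:
  fixes W :: "real \<times> real \<Rightarrow> real"
  assumes ab: "a \<le> b" and cont: "continuous_on (cbox (a, c) (b, d)) W'"
    and der: "\<And>x y. (x, y) \<in> cbox (a, c) (b, d) \<Longrightarrow> ((\<lambda>t. W (t, y)) has_vector_derivative W' (x, y)) (at x)"
  shows "integral (cbox (a, c) (b, d)) W' = integral {c..d} (\<lambda>y. W (b, y) - W (a, y))"
proof -
  have "integral (cbox (a, c) (b, d)) W' = integral (cbox a b) (\<lambda>x. integral (cbox c d) (\<lambda>y. W' (x, y)))"
    by (rule integral_prod_continuous[OF cont])
  also have "\<dots> = integral (cbox c d) (\<lambda>y. integral (cbox a b) (\<lambda>x. W' (x, y)))"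
    by (rule integral_swap_continuous[of a c b d "\<lambda>x y. W' (x, y)"]) (simp only: case_prod_eta cont)
  also have "\<dots> = integral (cbox c d) (\<lambda>y. W (b, y) - W (a, y))"
  proof (intro integral_cong integral_unique)
    fix y assume y: "y \<in> cbox c d"
    have "((\<lambda>t. W (t, y)) has_vector_derivative W' (x, y)) (at x within {a..b})" if "x \<in> {a..b}" for x
      using that y by (intro has_vector_derivative_at_within[OF der]) simp
    from fundamental_theorem_of_calculus[OF ab this]
    show "((\<lambda>x. W' (x, y)) has_integral W (b, y) - W (a, y)) (cbox a b)"
      by simp
  qed
  finally show ?thesis by simp
qed

lemma integral_py:
  fixes W :: "real \<times> real \<Rightarrow> real"
  assumes cd: "c \<le> d" and cont: "continuous_on (cbox (a, c) (b, d)) W'"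
    and der: "\<And>x y. (x, y) \<in> cbox (a, c) (b, d) \<Longrightarrow> ((\<lambda>t. W (x, t)) has_vector_derivative W' (x, y)) (at y)"
  shows "integral (cbox (a, c) (b, d)) W' = integral {a..b} (\<lambda>x. W (x, d) - W (x, c))"
proof -
  have "integral (cbox (a, c) (b, d)) W' = integral (cbox a b) (\<lambda>x. integral (cbox c d) (\<lambda>y. W' (x, y)))"
    by (rule integral_prod_continuous[OF cont])
  also have "\<dots> = integral (cbox a b) (\<lambda>x. W (x, d) - W (x, c))"
  proof (intro integral_cong integral_unique)
    fix x assume x: "x \<in> cbox a b"
    have "((\<lambda>t. W (x, t)) has_vector_derivative W' (x, y)) (at y within {c..d})" if "y \<in> {c..d}" for y
      using that x by (intro has_vector_derivative_at_within[OF der]) simp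
    from fundamental_theorem_of_calculus[OF cd this]
    show "((\<lambda>y. W' (x, y)) has_integral W (x, d) - W (x, c)) (cbox c d)"
      by simp
  qed
  finally show ?thesis by simp
qed

text \<open>The fundamental lemma of the calculus of variations. The weight may depend on the rectangle, so
  that the lemma serves both the bump functions and the constant weight \<open>1\<close>.\<close>

lemma zero_if_box_integrals_zero:
  fixes F :: "real \<times> real \<Rightarrow> real"
  assumes S: "open S" "z \<in> S" and F: "continuous_on S F"
    and int: "\<And>l r. z \<in> box l r \<Longrightarrow> cbox l r \<subseteq> S \<Longrightarrow>
      \<exists>w. continuous_on (cbox l r) w \<and> (\<forall>y\<in>box l r. w y > 0) \<and> integral (cbox l r) (\<lambda>y. F y * w y) = 0"
  shows "F z = 0"
proof (rule ccontr)
  assume "F z \<noteq> 0"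
  define G where "G y = sgn (F z) * F y" for y
  have Gz: "G z > 0" using \<open>F z \<noteq> 0\<close> by (simp add: G_def sgn_if)
  have contG: "continuous_on S G" unfolding G_def by (intro continuous_intros F)
  have "open (S \<inter> G -` {0<..})"
    using contG S(1) by (simp add: continuous_on_open_vimage Int_commute)
  then obtain l r where lr: "cbox l r \<subseteq> S \<inter> G -` {0<..}" "z \<in> box l r"
    using open_contains_cbox[of "S \<inter> G -` {0<..}" z] S(2) Gz by (metis IntI greaterThan_iff vimageI2)
  obtain w where w: "continuous_on (cbox l r) w" "\<forall>y\<in>box l r. w y > 0"
      "integral (cbox l r) (\<lambda>y. F y * w y) = 0"
    using int[of l r] lr by auto
  have "G z * w z = 0"
  proof (rule has_integral_0_cbox_imp_0[where f = "\<lambda>y. G y * w y"])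
    show c: "continuous_on (cbox l r) (\<lambda>y. G y * w y)"
      by (intro continuous_intros w continuous_on_subset[OF contG]) (use lr in auto)
    show "0 \<le> G x * w x" if "x \<in> box l r" for x
    proof -
      have "x \<in> cbox l r" using that box_subset_cbox by blast
      then have "G x > 0" using lr(1) by blast
      then show ?thesis using w(2) that by (simp add: less_imp_le)
    qed
    have "integral (cbox l r) (\<lambda>y. G y * w y) = 0"
      using w(3) by (simp add: G_def mult.assoc)
    with integrable_continuous[OF c] show "((\<lambda>y. G y * w y) has_integral 0) (cbox l r)"
      by (metis integrable_integral)
  qed (use lr(2) box_subset_cbox in auto)
  then show False using Gz w(2) lr(2) by fastforce
qed

text \<open>Over a rectangle, either mixed derivative integrates to the alternating sum of the values of \<open>v\<close>
  at the four corners.\<close>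

lemma mixed_partials_eq:
  fixes v :: "real \<times> real \<Rightarrow> real"
  assumes S: "open S" "z \<in> S" and v: "Ck_on 2 S v"
  shows "py (px v) z = px (py v) z"
proof -
  have v: "v differentiable_on S" "px v differentiable_on S" "py v differentiable_on S"
    "continuous_on S (px (py v))" "continuous_on S (py (px v))"
    using v by (auto simp: numeral_2_eq_2)
  have d: "v differentiable (at y)" "px v differentiable (at y)" "py v differentiable (at y)" if "y \<in> S" for y
    using v S that by (auto simp: differentiable_on_eq_differentiable_at)
  have "py (px v) z - px (py v) z = 0"
  proof (rule zero_if_box_integrals_zero[OF S])
    show "continuous_on S (\<lambda>z. py (px v) z - px (py v) z)" by (intro continuous_intros v)
    fix l r :: "real \<times> real" assume lr: "z \<in> box l r" "cbox l r \<subseteq> S"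
    obtain a c b d' where ac: "l = (a, c)" "r = (b, d')" by (cases l, cases r)
    have "a < b" "c < d'" using lr(1) by (auto simp: ac box_def Basis_prod_def)
    have I: "(x, y) \<in> S" if "x \<in> {a..b}" "y \<in> {c..d'}" for x y
      using lr(2) that by (auto simp: ac)
    have "integral (cbox l r) (py (px v)) = integral {a..b} (\<lambda>x. px v (x, d') - px v (x, c))"
      unfolding ac using lr \<open>c < d'\<close> v
      by (intro integral_py differentiable_py d) (auto simp: ac intro: continuous_on_subset)
    also have "\<dots> = (v (b, d') - v (b, c)) - (v (a, d') - v (a, c))"
      using \<open>a < b\<close> \<open>c < d'\<close>
      by (intro integral_unique fundamental_theorem_of_calculus derivative_intros
          has_vector_derivative_at_within[OF differentiable_px] d I) auto
    also have "\<dots> = (v (b, d') - v (a, d')) - (v (b, c) - v (a, c))" by simp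
    also have "\<dots> = integral {c..d'} (\<lambda>y. py v (b, y) - py v (a, y))"
      using \<open>a < b\<close> \<open>c < d'\<close>
      by (intro integral_unique[symmetric] fundamental_theorem_of_calculus
          [where f = "\<lambda>y. v (b, y) - v (a, y)", THEN has_integral_eq_rhs] derivative_intros
          has_vector_derivative_at_within[OF differentiable_py] d I) auto
    also have "\<dots> = integral (cbox l r) (px (py v))"
      unfolding ac using lr \<open>a < b\<close> v
      by (intro integral_px[symmetric] differentiable_px d) (auto simp: ac intro: continuous_on_subset)
    finally have "integral (cbox l r) (\<lambda>z. py (px v) z - px (py v) z) = 0"
      using v lr by (subst integral_diff) (auto intro!: integrable_continuous intro: continuous_on_subset)
    then show "\<exists>w. continuous_on (cbox l r) w \<and> (\<forall>y\<in>box l r. w y > 0) \<and>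
        integral (cbox l r) (\<lambda>y. (py (px v) y - px (py v) y) * w y) = 0"
      by (intro exI[of _ "\<lambda>_. 1"]) auto
  qed
  then show ?thesis by simp
qed

text \<open>Integration by parts against a bump that vanishes on the boundary of a rectangle moves the
  derivatives from the test function to the field.\<close>

lemma divergence_free_if_weakly:
  fixes V1 V2 :: "real \<times> real \<Rightarrow> real"
  assumes S: "open S" "S \<subseteq> \<Omega>" "z \<in> S"
    and cont: "continuous_on S V1" "continuous_on S V2" "continuous_on S D1" "continuous_on S D2"
    and d1: "\<And>x y. (x, y) \<in> S \<Longrightarrow> ((\<lambda>t. V1 (t, y)) has_vector_derivative D1 (x, y)) (at x)"
    and d2: "\<And>x y. (x, y) \<in> S \<Longrightarrow> ((\<lambda>t. V2 (x, t)) has_vector_derivative D2 (x, y)) (at y)"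
    and weak: "\<And>\<eta>. test_function S \<eta> \<Longrightarrow> (LINT z:\<Omega>|lborel. (V1 z, V2 z) \<bullet> grad \<eta> z) = 0"
  shows "D1 z + D2 z = 0"
proof (rule zero_if_box_integrals_zero[OF S(1,3)])
  show "continuous_on S (\<lambda>z. D1 z + D2 z)" by (intro continuous_intros cont)
  fix l r :: "real \<times> real" assume lr: "z \<in> box l r" "cbox l r \<subseteq> S"
  obtain a c b d where ac: "l = (a, c)" "r = (b, d)" by (cases l, cases r)
  have "a < b" "c < d" using lr(1) by (auto simp: ac box_def Basis_prod_def)
  let ?Q = "cbox l r" and ?\<eta> = "bump l r"
  have ck: "Ck_on (Suc 0) UNIV ?\<eta>" by (rule Ck_on_bump)
  then have bd: "?\<eta> differentiable (at z)" for z
    by (simp add: differentiable_on_def del: split_paired_All)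
  have bc: "continuous_on A ?\<eta>" "continuous_on A (px ?\<eta>)" "continuous_on A (py ?\<eta>)" for A
    using ck by (auto dest: differentiable_imp_continuous_on intro: continuous_on_subset)
  have cQ: "continuous_on ?Q V1" "continuous_on ?Q V2" "continuous_on ?Q D1" "continuous_on ?Q D2"
    using cont lr(2) by (auto intro: continuous_on_subset)
  \<comment> \<open>Off the rectangle the bump vanishes locally, so the integral over \<open>\<Omega>\<close> reduces to the rectangle.\<close>
  have "px ?\<eta> z = px (\<lambda>_. 0) z \<and> py ?\<eta> z = py (\<lambda>_. 0) z" if "z \<notin> ?Q" for z
    using that bump_nonzero_iff[of l r] box_subset_cbox[of l r]
    by (intro conjI px_cong_open[of "- ?Q"] py_cong_open[of "- ?Q"]) auto
  then have off: "px ?\<eta> z = 0 \<and> py ?\<eta> z = 0" if "z \<notin> ?Q" for z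
    using that by (simp add: px_def py_def)
  have cI: "continuous_on ?Q (\<lambda>z. V1 z * px ?\<eta> z + V2 z * py ?\<eta> z)"
    by (intro continuous_intros cQ bc)
  have "0 = (LINT z:\<Omega>|lborel. (V1 z, V2 z) \<bullet> grad ?\<eta> z)"
    using weak[OF test_function_bump[OF lr(2)]] by simp
  also have "\<dots> = (LINT z:?Q|lborel. V1 z * px ?\<eta> z + V2 z * py ?\<eta> z)"
    unfolding set_lebesgue_integral_def
    by (rule Bochner_Integration.integral_cong)
       (use off lr(2) S(2) in \<open>auto simp: grad_def inner_prod_def indicator_def\<close>)
  also have "\<dots> = integral ?Q (\<lambda>z. V1 z * px ?\<eta> z + V2 z * py ?\<eta> z)"
    by (rule set_borel_integral_eq_integral)
       (use borel_integrable_compact[OF compact_cbox cI] in \<open>simp add: set_integrable_def\<close>)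
  finally have 0: "integral ?Q (\<lambda>z. V1 z * px ?\<eta> z + V2 z * py ?\<eta> z) = 0" by simp
  have edge: "?\<eta> (a, y) = 0" "?\<eta> (b, y) = 0" "?\<eta> (x, c) = 0" "?\<eta> (x, d) = 0" for x y
    by (auto simp: bump_def flat_def ac)
  have 1: "integral ?Q (\<lambda>z. V1 z * px ?\<eta> z + D1 z * ?\<eta> z) = 0"
  proof -
    have "integral ?Q (\<lambda>z. V1 z * px ?\<eta> z + D1 z * ?\<eta> z) =
        integral {c..d} (\<lambda>y. V1 (b, y) * ?\<eta> (b, y) - V1 (a, y) * ?\<eta> (a, y))"
      unfolding ac
      by (rule integral_px[where W = "\<lambda>z. V1 z * bump (a, c) (b, d) z"])
         (use \<open>a < b\<close> cQ bc lr(2) ac in \<open>auto intro!: continuous_intros has_vector_derivative_mult d1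
          differentiable_px bd[unfolded ac]\<close>)
    then show ?thesis by (simp add: edge)
  qed
  have 2: "integral ?Q (\<lambda>z. V2 z * py ?\<eta> z + D2 z * ?\<eta> z) = 0"
  proof -
    have "integral ?Q (\<lambda>z. V2 z * py ?\<eta> z + D2 z * ?\<eta> z) =
        integral {a..b} (\<lambda>x. V2 (x, d) * ?\<eta> (x, d) - V2 (x, c) * ?\<eta> (x, c))"
      unfolding ac
      by (rule integral_py[where W = "\<lambda>z. V2 z * bump (a, c) (b, d) z"])
         (use \<open>c < d\<close> cQ bc lr(2) ac in \<open>auto intro!: continuous_intros has_vector_derivative_mult d2
          differentiable_py bd[unfolded ac]\<close>)
    then show ?thesis by (simp add: edge)
  qed
  have i: "integral ?Q (\<lambda>z. (V1 z * px ?\<eta> z + D1 z * ?\<eta> z) +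
      (V2 z * py ?\<eta> z + D2 z * ?\<eta> z) - (V1 z * px ?\<eta> z + V2 z * py ?\<eta> z)) = 0 + 0 - 0"
    by (intro integral_unique has_integral_diff has_integral_add)
       (use 0 1 2 in \<open>auto simp: has_integral_iff intro!: integrable_continuous continuous_intros cQ bc\<close>)
  have e: "(D1 z + D2 z) * ?\<eta> z = (V1 z * px ?\<eta> z + D1 z * ?\<eta> z) +
      (V2 z * py ?\<eta> z + D2 z * ?\<eta> z) - (V1 z * px ?\<eta> z + V2 z * py ?\<eta> z)" for z
    by (simp add: algebra_simps)
  have "integral ?Q (\<lambda>z. (D1 z + D2 z) * ?\<eta> z) = 0"
    unfolding e using i by simp
  then show "\<exists>w. continuous_on ?Q w \<and> (\<forall>y\<in>box l r. w y > 0) \<and>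
      integral ?Q (\<lambda>y. (D1 y + D2 y) * w y) = 0"
    by (intro exI[of _ ?\<eta>]) (auto simp: bc bump_pos)
qed

section \<open>Algebra of the pointwise system\<close>

text \<open>For \<open>p < 2\<close> the term with \<open>(p - 2)/2 |Y|\<^sup>2\<close> is negative, but by Cauchy-Schwarz it absorbs at most
  the fraction \<open>1 - p/2\<close> of \<open>N (L\<^sup>2 + K\<^sup>2)\<close>; this is where the constant degenerates as \<open>p\<close> tends
  to zero.\<close>

lemma trace_bound:
  fixes A B H G :: complex and L K p :: real
  defines "N \<equiv> (norm A)\<^sup>2 + (norm B)\<^sup>2"
    and "Z \<equiv> cnj (L * A + K * B) / 2 + H * A + G * B"
  assumes p: "0 < p" and N: "0 < N"
    and eq1: "N * L + (p - 2) * Re (Z * A) = 0"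
    and eq2: "N * K + (p - 2) * Re (Z * B) = 0"
  shows "min 1 (p / 2) * sqrt (L\<^sup>2 + K\<^sup>2) \<le> \<bar>p - 2\<bar> * (norm H + norm G)"
proof -
  define Y where "Y = L * A + K * B"
  define S where "S = sqrt (L\<^sup>2 + K\<^sup>2)"
  define m where "m = min 1 (p / 2)"
  have S2: "S\<^sup>2 = L\<^sup>2 + K\<^sup>2" by (simp add: S_def)
  have "S \<ge> 0" by (simp add: S_def)
  have CS: "(x * y + x' * y')\<^sup>2 \<le> (x\<^sup>2 + x'\<^sup>2) * (y\<^sup>2 + y'\<^sup>2)" for x y x' y' :: real
  proof -
    have "(x\<^sup>2 + x'\<^sup>2) * (y\<^sup>2 + y'\<^sup>2) - (x * y + x' * y')\<^sup>2 = (x * y' - x' * y)\<^sup>2"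
      by (simp add: power2_eq_square algebra_simps)
    then show ?thesis by (metis diff_ge_0_iff_ge zero_le_power2)
  qed
  have nY: "norm Y \<le> S * sqrt N"
  proof -
    have "norm Y \<le> \<bar>L\<bar> * norm A + \<bar>K\<bar> * norm B"
      unfolding Y_def by (rule order_trans[OF norm_triangle_ineq]) (simp add: norm_mult)
    also have "\<dots> \<le> sqrt ((L\<^sup>2 + K\<^sup>2) * N)"
      using CS[of "\<bar>L\<bar>" "norm A" "\<bar>K\<bar>" "norm B"] by (intro real_le_rsqrt) (simp add: N_def)
    finally show ?thesis by (simp add: S_def real_sqrt_mult)
  qed
  have nA: "norm A \<le> sqrt N" "norm B \<le> sqrt N"
    by (auto simp: N_def intro!: real_le_rsqrt)
  have nQ: "norm (H * A + G * B) \<le> sqrt N * (norm H + norm G)"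
    using mult_left_mono[OF nA(1), of "norm H"] mult_left_mono[OF nA(2), of "norm G"]
    by (intro order_trans[OF norm_triangle_ineq]) (simp add: norm_mult algebra_simps)
  have "0 = (N * L + (p - 2) * Re (Z * A)) * L + (N * K + (p - 2) * Re (Z * B)) * K"
    using eq1 eq2 by simp
  also have "\<dots> = N * S\<^sup>2 + (p - 2) * Re (Z * Y)"
    unfolding S2 by (simp add: Y_def algebra_simps power2_eq_square)
  also have "Z * Y = of_real ((norm Y)\<^sup>2 / 2) + (H * A + G * B) * Y"
  proof -
    have "Z = cnj Y / 2 + (H * A + G * B)" by (simp add: Z_def Y_def)
    moreover have "complex_of_real ((norm Y)\<^sup>2 / 2) = cnj Y * Y / 2"
      by (simp add: complex_norm_square mult.commute flip: of_real_power)
    ultimately show ?thesis by (simp add: algebra_simps)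
  qed
  finally have key: "N * S\<^sup>2 + (p - 2) / 2 * (norm Y)\<^sup>2 = - (p - 2) * Re ((H * A + G * B) * Y)"
    by (simp add: algebra_simps)
  have Y2: "(norm Y)\<^sup>2 \<le> S\<^sup>2 * N"
    using power_mono[OF nY norm_ge_zero, of 2] N by (simp add: power_mult_distrib)
  have "m * (N * S\<^sup>2) \<le> N * S\<^sup>2 + (p - 2) / 2 * (norm Y)\<^sup>2"
  proof (cases "p \<ge> 2")
    case True
    then show ?thesis by (simp add: m_def min_def)
  next
    case False
    then have le: "(p - 2) / 2 * (S\<^sup>2 * N) \<le> (p - 2) / 2 * (norm Y)\<^sup>2"
      by (intro mult_left_mono_neg Y2) simp
    have eq: "p / 2 * (N * S\<^sup>2) = N * S\<^sup>2 + (p - 2) / 2 * (S\<^sup>2 * N)"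
      by (simp add: field_simps)
    have "m = p / 2" using False by (simp add: m_def)
    then show ?thesis using add_left_mono[OF le, of "N * S\<^sup>2"] by (simp only: eq)
  qed
  also have "\<dots> \<le> \<bar>p - 2\<bar> * (norm (H * A + G * B) * norm Y)"
  proof -
    have "- (p - 2) * Re ((H * A + G * B) * Y) \<le> \<bar>- (p - 2) * Re ((H * A + G * B) * Y)\<bar>"
      by (rule abs_ge_self)
    also have "\<dots> = \<bar>p - 2\<bar> * \<bar>Re ((H * A + G * B) * Y)\<bar>"
      by (simp only: abs_mult abs_minus_cancel)
    also have "\<dots> \<le> \<bar>p - 2\<bar> * norm ((H * A + G * B) * Y)"
      by (intro mult_left_mono abs_Re_le_cmod abs_ge_zero)
    finally show ?thesis unfolding key norm_mult[of _ Y] .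
  qed
  also have "\<dots> \<le> \<bar>p - 2\<bar> * ((sqrt N * (norm H + norm G)) * (S * sqrt N))"
    by (intro mult_left_mono mult_mono nQ nY) (use N in auto)
  also have "\<dots> = (sqrt N * sqrt N) * S * (\<bar>p - 2\<bar> * (norm H + norm G))"
    by (simp only: mult_ac)
  also have "sqrt N * sqrt N = N" using N by simp
  finally have fin: "N * S * (m * S) \<le> N * S * (\<bar>p - 2\<bar> * (norm H + norm G))"
    by (simp add: power2_eq_square algebra_simps)
  show ?thesis
  proof (cases "S = 0")
    case True
    then show ?thesis by (simp add: S_def)
  next
    case False
    then have "m * S \<le> \<bar>p - 2\<bar> * (norm H + norm G)"
      using fin N \<open>S \<ge> 0\<close> by (auto simp: mult_le_cancel_left_pos)
    then show ?thesis by (simp add: m_def S_def)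
  qed
qed

text \<open>The Hessian of \<open>v\<close> splits into \<open>\<Delta>v/2\<close> times the identity and the trace-free part \<open>H\<close>. The first
  contributes only to the curvature of the level curves; the second enters through \<open>H (v\<^sub>x + i v\<^sub>y)\<^sup>2\<close>.\<close>

lemma phi_bound:
  assumes f: "complex_gradient v z \<noteq> 0"
    and H: "H = Complex ((px (px v) z - py (py v) z) / 2) (- py (px v) z)"
  shows "norm (phi v z) * norm (complex_gradient v z) \<le> \<bar>px (px v) z + py (py v) z\<bar> / 4 + norm H / 2"
proof -
  define a b where "a = px v z" "b = py v z"
  define L where "L = px (px v) z + py (py v) z"
  define F where "F = Complex a b"
  have nf: "norm (complex_gradient v z) = norm F / 2"
  proof -
    have "complex_gradient v z = cnj F / 2"
      by (simp add: complex_gradient_def F_def a_b_def complex_eq_iff)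
    then show ?thesis by (simp only: norm_divide complex_mod_cnj norm_numeral)
  qed
  have "norm F > 0" using f nf by auto
  have gF: "norm (grad v z) = norm F"
    by (simp add: grad_def norm_prod_def F_def a_b_def cmod_def)
  have F2: "(norm F)\<^sup>2 = a\<^sup>2 + b\<^sup>2" by (simp add: F_def cmod_power2)
  define k h where "k = level_curvature v z" "h = descent_curvature v z"
  have k: "k * norm F ^ 3 = - (b\<^sup>2 * px (px v) z - 2 * a * b * py (px v) z + a\<^sup>2 * py (py v) z)"
    and h: "h * norm F ^ 3 = (px (px v) z - py (py v) z) * a * b - py (px v) z * (a\<^sup>2 - b\<^sup>2)"
    using \<open>norm F > 0\<close>
    by (simp_all add: k_h_def level_curvature_def descent_curvature_def gF flip: a_b_def)
  have "phi v z * of_real (norm F ^ 3) = Complex (k * norm F ^ 3) (h * norm F ^ 3)"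
    by (simp add: phi_def complex_eq_iff k_h_def)
  also have "\<dots> = H * F\<^sup>2 - of_real ((norm F)\<^sup>2 * L / 2)"
    unfolding k h F2 unfolding H F_def L_def power2_eq_square complex_eq_iff
    by (simp add: field_simps)
  finally have e: "phi v z * of_real (norm F ^ 3) = H * F\<^sup>2 - of_real ((norm F)\<^sup>2 * L / 2)" .
  have "norm (phi v z) * norm F ^ 3 = norm (H * F\<^sup>2 - of_real ((norm F)\<^sup>2 * L / 2))"
    unfolding e[symmetric] by (simp add: norm_mult norm_power)
  also have "\<dots> \<le> norm (H * F\<^sup>2) + norm (complex_of_real ((norm F)\<^sup>2 * L / 2))"
    by (rule norm_triangle_ineq4)
  also have "\<dots> = (norm F)\<^sup>2 * (\<bar>L\<bar> / 2 + norm H)"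
    unfolding norm_of_real norm_mult norm_power by (simp add: abs_mult algebra_simps)
  finally have "norm (phi v z) * norm F ^ 3 \<le> (norm F)\<^sup>2 * (\<bar>L\<bar> / 2 + norm H)" .
  then have "(norm F)\<^sup>2 * (norm (phi v z) * norm F) \<le> (norm F)\<^sup>2 * (\<bar>L\<bar> / 2 + norm H)"
    by (simp add: algebra_simps power2_eq_square power3_eq_cube)
  then have "norm (phi v z) * norm F \<le> \<bar>L\<bar> / 2 + norm H"
    using \<open>norm F > 0\<close> by (simp add: mult_le_cancel_left_pos)
  then show ?thesis by (simp add: nf L_def)
qed

section \<open>The curvature estimate\<close>

lemma dz_complex_gradient:
  assumes "px v differentiable (at z)" "py v differentiable (at z)" "py (px v) z = px (py v) z"
  shows "dz (complex_gradient v) z = Complex ((px (px v) z - py (py v) z) / 2) (- py (px v) z) / 2"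
proof -
  obtain x y where z: "z = (x, y)" by (cases z)
  define T where "T ab = (complex_of_real (fst ab) - \<i> * complex_of_real (snd ab)) / 2" for ab :: "real \<times> real"
  have T: "bounded_linear T"
    unfolding T_def
    by (intro bounded_linear_compose[OF bounded_linear_divide] bounded_linear_sub bounded_linear_const_mult
        bounded_linear_compose[OF bounded_linear_of_real] bounded_linear_fst bounded_linear_snd)
  have "((\<lambda>t. T (px v (t, y), py v (t, y))) has_vector_derivative T (px (px v) z, px (py v) z)) (at x)"
    using assms unfolding z
    by (intro bounded_linear.has_vector_derivative[OF T] has_vector_derivative_Pair differentiable_px)
  then have x: "px (complex_gradient v) z = T (px (px v) z, px (py v) z)"
    unfolding z by (intro px_eqI) (simp add: complex_gradient_def T_def)
  have "((\<lambda>t. T (px v (x, t), py v (x, t))) has_vector_derivative T (py (px v) z, py (py v) z)) (at y)"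
    using assms unfolding z
    by (intro bounded_linear.has_vector_derivative[OF T] has_vector_derivative_Pair differentiable_py)
  then have y: "py (complex_gradient v) z = T (py (px v) z, py (py v) z)"
    unfolding z by (intro py_eqI) (simp add: complex_gradient_def T_def)
  show ?thesis
    unfolding dz_def x y T_def assms(3) by (simp add: complex_eq_iff field_simps)
qed

text \<open>The two bracketed sums are \<open>N\<^sub>x / 2\<close> and \<open>N\<^sub>y / 2\<close>: this is the equation
  \<open>N \<Delta>v + (p - 2)/2 \<nabla>N \<bullet> \<nabla>v = 0\<close>, obtained by differentiating \<open>N powr ((p - 2)/2) *\<^sub>R \<nabla>v\<close> and
  dividing by a power of \<open>N\<close>.\<close>

lemma p_laplace_pointwise:
  fixes v w :: "real \<times> real \<Rightarrow> real" and p :: real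
  defines "N \<equiv> \<lambda>z. (px v z)\<^sup>2 + (py v z)\<^sup>2 + (px w z)\<^sup>2 + (py w z)\<^sup>2"
  assumes \<Omega>: "open \<Omega>" "z \<in> \<Omega>" and C2: "Ck_on 2 \<Omega> v" "Ck_on 2 \<Omega> w" and Nz: "0 < N z"
    and weak: "\<And>\<eta>. test_function \<Omega> \<eta> \<Longrightarrow>
      (LINT z:\<Omega>|lborel. (sqrt (N z) powr (p - 2) *\<^sub>R grad v z) \<bullet> grad \<eta> z) = 0"
  shows "N z * (px (px v) z + py (py v) z) + (p - 2) *
      ((px v z * px (px v) z + py v z * px (py v) z + px w z * px (px w) z + py w z * px (py w) z) * px v z
     + (px v z * py (px v) z + py v z * py (py v) z + px w z * py (px w) z + py w z * py (py w) z) * py v z) = 0"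
proof -
  define s where "s = (p - 2) / 2"
  have ps: "p - 2 = 2 * s" by (simp add: s_def)
  define S where "S = \<Omega> \<inter> N -` {0<..}"
  define Nx where "Nx z = px v z * px (px v) z + py v z * px (py v) z + px w z * px (px w) z + py w z * px (py w) z" for z
  define Ny where "Ny z = px v z * py (px v) z + py v z * py (py v) z + px w z * py (px w) z + py w z * py (py w) z" for z
  define D1 where "D1 z = N z powr s * px (px v) z + (p - 2) * N z powr (s - 1) * Nx z * px v z" for z
  define D2 where "D2 z = N z powr s * py (py v) z + (p - 2) * N z powr (s - 1) * Ny z * py v z" for z
  note C2' = C2[unfolded numeral_2_eq_2 Ck_on.simps]
  have d: "px v differentiable (at y)" "py v differentiable (at y)"
      "px w differentiable (at y)" "py w differentiable (at y)" if "y \<in> \<Omega>" for y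
    using C2' \<Omega>(1) that by (simp_all add: differentiable_on_eq_differentiable_at del: split_paired_All)
  have c1: "continuous_on \<Omega> (px v)" "continuous_on \<Omega> (py v)" "continuous_on \<Omega> (px w)" "continuous_on \<Omega> (py w)"
    using C2' by (simp_all add: differentiable_imp_continuous_on)
  have cN: "continuous_on \<Omega> N" unfolding N_def by (intro continuous_intros c1)
  have S: "open S" "S \<subseteq> \<Omega>" "z \<in> S"
    using cN \<Omega> Nz by (auto simp: S_def continuous_on_open_vimage Int_commute)
  have N0: "N y > 0" if "y \<in> S" for y using that by (simp add: S_def)
  have c: "continuous_on S (px v)" "continuous_on S (py v)" "continuous_on S (px w)" "continuous_on S (py w)"
    "continuous_on S N"
    "continuous_on S (px (px v))" "continuous_on S (py (px v))" "continuous_on S (px (py v))" "continuous_on S (py (py v))"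
    "continuous_on S (px (px w))" "continuous_on S (py (px w))" "continuous_on S (px (py w))" "continuous_on S (py (py w))"
    using c1 cN C2' S(2) by (blast intro: continuous_on_subset)+
  \<comment> \<open>Also where \<open>N\<close> vanishes, since \<open>0 powr a = 0\<close>; hence the weak equation on all of \<open>\<Omega>\<close> is unchanged.\<close>
  have powr: "N y powr s = sqrt (N y) powr (p - 2)" for y
  proof -
    have "N y \<ge> 0" by (simp add: N_def)
    then show ?thesis by (simp add: s_def powr_powr flip: powr_half_sqrt)
  qed
  have "D1 z + D2 z = 0"
  proof (rule divergence_free_if_weakly[OF S,
        where ?V1.0 = "\<lambda>z. N z powr s * px v z" and ?V2.0 = "\<lambda>z. N z powr s * py v z"])
    show "continuous_on S (\<lambda>z. N z powr s * px v z)" "continuous_on S (\<lambda>z. N z powr s * py v z)"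
      "continuous_on S D1" "continuous_on S D2"
      unfolding D1_def D2_def Nx_def Ny_def
      by (intro continuous_intros c; use N0 in force)+
    fix x y assume xy: "(x, y) \<in> S"
    note pd = d[OF subsetD[OF S(2) xy], THEN differentiable_px, folded has_real_derivative_iff_has_vector_derivative]
    have "((\<lambda>t. N (t, y)) has_real_derivative 2 * Nx (x, y)) (at x)"
      unfolding N_def Nx_def by (auto intro!: derivative_eq_intros pd simp: algebra_simps)
    from DERIV_mult[OF DERIV_chain2[OF has_real_derivative_powr[OF N0[OF xy], of s] this] pd(1)]
    show "((\<lambda>t. N (t, y) powr s * px v (t, y)) has_vector_derivative D1 (x, y)) (at x)"
      by (simp add: D1_def ps algebra_simps flip: has_real_derivative_iff_has_vector_derivative)
    note pd = d[OF subsetD[OF S(2) xy], THEN differentiable_py, folded has_real_derivative_iff_has_vector_derivative]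
    have "((\<lambda>t. N (x, t)) has_real_derivative 2 * Ny (x, y)) (at y)"
      unfolding N_def Ny_def by (auto intro!: derivative_eq_intros pd simp: algebra_simps)
    from DERIV_mult[OF DERIV_chain2[OF has_real_derivative_powr[OF N0[OF xy], of s] this] pd(2)]
    show "((\<lambda>t. N (x, t) powr s * py v (x, t)) has_vector_derivative D2 (x, y)) (at y)"
      by (simp add: D2_def ps algebra_simps flip: has_real_derivative_iff_has_vector_derivative)
  next
    fix \<eta> assume "test_function S \<eta>"
    then have "test_function \<Omega> \<eta>" using S(2) by (auto simp: test_function_def)
    from weak[OF this] show "(LINT z:\<Omega>|lborel. (N z powr s * px v z, N z powr s * py v z) \<bullet> grad \<eta> z) = 0"
      by (simp add: grad_def powr)
  qed
  also have "D1 z + D2 z = N z powr (s - 1) * (N z * (px (px v) z + py (py v) z) + (p - 2) * (Nx z * px v z + Ny z * py v z))"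
  proof -
    have "N z powr s = N z powr (s - 1) * N z"
      using Nz powr_add[of "N z" "s - 1" 1] by simp
    then show ?thesis by (simp add: D1_def D2_def algebra_simps)
  qed
  finally show ?thesis using Nz by (simp add: Nx_def Ny_def)
qed

text \<open>Stated for one component \<open>v\<close> and its partner \<open>w\<close>, since the system is symmetric in the two.\<close>

lemma phi_bound_of_weak_solutions:
  fixes v w :: "real \<times> real \<Rightarrow> real" and p :: real
  defines "N \<equiv> \<lambda>z. (px v z)\<^sup>2 + (py v z)\<^sup>2 + (px w z)\<^sup>2 + (py w z)\<^sup>2"
  assumes p: "0 < p" and \<Omega>: "open \<Omega>" "z \<in> \<Omega>" and C2: "Ck_on 2 \<Omega> v" "Ck_on 2 \<Omega> w"
    and f: "complex_gradient v z \<noteq> 0"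
    and weak: "\<And>\<eta>. test_function \<Omega> \<eta> \<Longrightarrow>
      (LINT z:\<Omega>|lborel. (sqrt (N z) powr (p - 2) *\<^sub>R grad v z) \<bullet> grad \<eta> z) = 0"
      "\<And>\<eta>. test_function \<Omega> \<eta> \<Longrightarrow>
      (LINT z:\<Omega>|lborel. (sqrt (N z) powr (p - 2) *\<^sub>R grad w z) \<bullet> grad \<eta> z) = 0"
  shows "norm (phi v z) * norm (complex_gradient v z) \<le>
    (1 + \<bar>p - 2\<bar> / (2 * min 1 (p / 2))) * (norm (dz (complex_gradient v) z) + norm (dz (complex_gradient w) z))"
proof -
  define A where "A = Complex (px v z) (py v z)"
  define B where "B = Complex (px w z) (py w z)"
  define H where "H = Complex ((px (px v) z - py (py v) z) / 2) (- py (px v) z)"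
  define G where "G = Complex ((px (px w) z - py (py w) z) / 2) (- py (px w) z)"
  define L where "L = px (px v) z + py (py v) z"
  define K where "K = px (px w) z + py (py w) z"
  define m where "m = min 1 (p / 2)"
  have m: "m > 0" using p by (simp add: m_def)
  note C2' = C2[unfolded numeral_2_eq_2 Ck_on.simps]
  have d: "px v differentiable (at z)" "py v differentiable (at z)"
      "px w differentiable (at z)" "py w differentiable (at z)"
    using C2' \<Omega> by (simp_all add: differentiable_on_eq_differentiable_at del: split_paired_All)
  have sym: "py (px v) z = px (py v) z" "py (px w) z = px (py w) z"
    using mixed_partials_eq \<Omega> C2 by blast+
  have dzv: "dz (complex_gradient v) z = H / 2" and dzw: "dz (complex_gradient w) z = G / 2"
    unfolding H_def G_def by (intro dz_complex_gradient d sym)+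
  have N: "N z = (norm A)\<^sup>2 + (norm B)\<^sup>2"
    by (simp add: N_def A_def B_def cmod_power2)
  have "A \<noteq> 0" using f by (auto simp: A_def complex_gradient_def complex_eq_iff)
  then have Nz: "N z > 0" unfolding N by (simp add: add_pos_nonneg)
  have comm: "N z = (px w z)\<^sup>2 + (py w z)\<^sup>2 + (px v z)\<^sup>2 + (py v z)\<^sup>2" for z
    by (simp add: N_def)
  \<comment> \<open>The bracket is half of \<open>N\<^sub>x - i N\<^sub>y\<close>, split according to trace and trace-free parts of the Hessians.\<close>
  have ev: "N z * L + (p - 2) * Re ((cnj (L * A + K * B) / 2 + H * A + G * B) * A) = 0"
  proof -
    have "Re ((cnj (L * A + K * B) / 2 + H * A + G * B) * A) =
      (px v z * px (px v) z + py v z * px (py v) z + px w z * px (px w) z + py w z * px (py w) z) * px v z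
     + (px v z * py (px v) z + py v z * py (py v) z + px w z * py (px w) z + py w z * py (py w) z) * py v z"
      unfolding sym[symmetric] by (simp add: A_def B_def H_def G_def L_def K_def field_simps)
    then show ?thesis
      using p_laplace_pointwise[OF \<Omega> C2, of p] Nz weak(1) unfolding N_def L_def by simp
  qed
  have ew: "N z * K + (p - 2) * Re ((cnj (L * A + K * B) / 2 + H * A + G * B) * B) = 0"
  proof -
    have "Re ((cnj (L * A + K * B) / 2 + H * A + G * B) * B) =
      (px w z * px (px w) z + py w z * px (py w) z + px v z * px (px v) z + py v z * px (py v) z) * px w z
     + (px w z * py (px w) z + py w z * py (py w) z + px v z * py (px v) z + py v z * py (py v) z) * py w z"
      unfolding sym[symmetric] by (simp add: A_def B_def H_def G_def L_def K_def field_simps)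
    then show ?thesis
      using p_laplace_pointwise[OF \<Omega> C2(2,1), of p] Nz weak(2) unfolding comm K_def by simp
  qed
  have "m * \<bar>L\<bar> \<le> m * sqrt (L\<^sup>2 + K\<^sup>2)"
    using m by (intro mult_left_mono real_le_rsqrt) auto
  also have "\<dots> \<le> \<bar>p - 2\<bar> * (norm H + norm G)"
    unfolding m_def using trace_bound[OF p, of A B L K H G] Nz ev ew by (simp add: N)
  finally have "\<bar>L\<bar> \<le> \<bar>p - 2\<bar> / m * (norm H + norm G)"
    using m by (simp add: field_simps)
  moreover have "norm (phi v z) * norm (complex_gradient v z) \<le> \<bar>L\<bar> / 4 + norm H / 2"
    unfolding L_def by (rule phi_bound[OF f H_def])
  moreover have "x \<le> q / 4 + (h + g) / 2" if "l \<le> q" "x \<le> l / 4 + h / 2" "0 \<le> g" for x l q h g :: real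
    using that by (simp add: field_simps)
  ultimately have "norm (phi v z) * norm (complex_gradient v z) \<le>
      \<bar>p - 2\<bar> / m * (norm H + norm G) / 4 + (norm H + norm G) / 2"
    using norm_ge_zero by blast
  also have "\<dots> = (1 + \<bar>p - 2\<bar> / (2 * m)) * (norm (H / 2) + norm (G / 2))"
    using m by (simp add: norm_divide field_simps)
  finally show ?thesis by (simp only: dzv dzw m_def)
qed

theorem theorem4:
  fixes p :: real
  assumes "1 < p"
  shows "\<exists>C::real. \<forall>(\<Omega> :: (real \<times> real) set) (u :: real \<times> real \<Rightarrow> real \<times> real).
    open \<Omega> \<and> connected \<Omega> \<and> \<Omega> \<noteq> {} \<and> Ck_on 2 \<Omega> u \<and> p_harmonic p \<Omega> u \<longrightarrow>
    (let f = complex_gradient (fst \<circ> u); g = complex_gradient (snd \<circ> u) in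
      \<forall>z\<in>\<Omega>. f z \<noteq> 0 \<and> g z \<noteq> 0 \<longrightarrow>
        norm (phi (fst \<circ> u) z) * norm (f z) \<le> C * (norm (dz f z) + norm (dz g z)) \<and>
        norm (phi (snd \<circ> u) z) * norm (g z) \<le> C * (norm (dz f z) + norm (dz g z)))"
proof -
  define C where "C = 1 + \<bar>p - 2\<bar> / (2 * min 1 (p / 2))"
  have "norm (phi (fst \<circ> u) z) * norm (complex_gradient (fst \<circ> u) z) \<le>
        C * (norm (dz (complex_gradient (fst \<circ> u)) z) + norm (dz (complex_gradient (snd \<circ> u)) z)) \<and>
      norm (phi (snd \<circ> u) z) * norm (complex_gradient (snd \<circ> u) z) \<le>
        C * (norm (dz (complex_gradient (fst \<circ> u)) z) + norm (dz (complex_gradient (snd \<circ> u)) z))"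
    if \<Omega>: "open \<Omega>" "z \<in> \<Omega>" and C2: "Ck_on 2 \<Omega> u" and u: "p_harmonic p \<Omega> u"
      and f: "complex_gradient (fst \<circ> u) z \<noteq> 0" and g: "complex_gradient (snd \<circ> u) z \<noteq> 0" for \<Omega> u z
  proof -
    have v: "Ck_on 2 \<Omega> (fst \<circ> u)" and w: "Ck_on 2 \<Omega> (snd \<circ> u)"
      using Ck_on_bounded_linear \<Omega>(1) C2 bounded_linear_fst bounded_linear_snd by blast+
    have N: "norm_D u y = sqrt ((px (fst \<circ> u) y)\<^sup>2 + (py (fst \<circ> u) y)\<^sup>2 +
        (px (snd \<circ> u) y)\<^sup>2 + (py (snd \<circ> u) y)\<^sup>2)" for y
      by (simp add: norm_D_def grad_def norm_prod_def)
    have N': "norm_D u y = sqrt ((px (snd \<circ> u) y)\<^sup>2 + (py (snd \<circ> u) y)\<^sup>2 +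
        (px (fst \<circ> u) y)\<^sup>2 + (py (fst \<circ> u) y)\<^sup>2)" for y
      unfolding N by (simp add: add_ac)
    have p: "0 < p" using assms by simp
    have weak: "(LINT z:\<Omega>|lborel. (norm_D u z powr (p - 2) *\<^sub>R grad (fst \<circ> u) z) \<bullet> grad \<eta> z) = 0"
      "(LINT z:\<Omega>|lborel. (norm_D u z powr (p - 2) *\<^sub>R grad (snd \<circ> u) z) \<bullet> grad \<eta> z) = 0"
      if "test_function \<Omega> \<eta>" for \<eta>
      using u that by (auto simp: p_harmonic_def)
    show ?thesis
      using phi_bound_of_weak_solutions[OF p \<Omega> v w f weak[unfolded N]]
        phi_bound_of_weak_solutions[OF p \<Omega> w v g weak(2,1)[unfolded N']]
      by (simp add: C_def add.commute)
  qed
  then show ?thesis unfolding Let_def by blast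
qed

end
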